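(* Let $P$ be a distribution on $\mathbb{R}^k$ with an elliptically contoured density $|\mathbf{\Sigma}|^{-1/2}g\big((\mathbf{y}-\boldsymbol\mu)^T\mathbf{\Sigma}^{-1}(\mathbf{y}-\boldsymbol\mu)\big)$, where $\boldsymbol\mu\in\mathbb{R}^k$ and $\mathbf{\Sigma}\in\mathrm{PDS}(k)$. Suppose that $\mathbf{\Sigma}=\mathbf{V}(\boldsymbol\theta_0)$ for some $\boldsymbol\theta_0\in\mathbb{R}^\ell$, where $\mathbf{V}(\boldsymbol\theta)=\theta_1\mathbf{L}_1+\cdots+\theta_\ell\mathbf{L}_\ell$ is linear with symmetric $k\times k$ matrices $\mathbf{L}_j$ such that $\mathbf{L}=[\mathrm{vec}(\mathbf{L}_1)\ \cdots\ \mathrm{vec}(\mathbf{L}_\ell)]$ is of full column rank. Write $d(\mathbf{y})^2=(\mathbf{y}-\boldsymbol\mu)^T\mathbf{\Sigma}^{-1}(\mathbf{y}-\boldsymbol\mu)$, $d(\mathbf{y})\ge0$, and let $\alpha_C,\beta_C:[0,\infty)\to\mathbb{R}$ be functions. (i) Let $\mathbf{M}\in\mathrm{PDS}(k)$ be a covariance functional that is Fisher consistent for $\mathbf{\Sigma}$ and which possesses an influence function given by $$\mathrm{IF}(\mathbf{y};\mathrm{vec}(\mathbf{M}),P)=\alpha_C(d(\mathbf{y}))\,\mathbf{L}\big(\mathbf{L}^T(\mathbf{\Sigma}^{-1}\otimes\mathbf{\Sigma}^{-1})\mathbf{L}\big)^{-1}\mathbf{L}^T\,\mathrm{vec}\big(\mathbf{\Sigma}^{-1}(\mathbf{y}-\boldsymbol\mu)(\mathbf{y}-\boldsymbol\mu)^T\mathbf{\Sigma}^{-1}\big)-\beta_C(d(\mathbf{y}))\,\mathrm{vec}(\mathbf{\Sigma}).$$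 Let $H(\mathbf{M})\in\mathbb{R}^m$ be continuously differentiable in a neighborhood of $\mathbf{M}(P)$ and homogeneous of order zero. Then $\mathrm{IF}(\mathbf{y};H(\mathbf{M}),P)$ is given by $$\alpha_C(d(\mathbf{y}))\,H'(\mathbf{\Sigma})\,\mathbf{L}\big(\mathbf{L}^T(\mathbf{\Sigma}^{-1}\otimes\mathbf{\Sigma}^{-1})\mathbf{L}\big)^{-1}\mathbf{L}^T(\mathbf{\Sigma}^{-1}\otimes\mathbf{\Sigma}^{-1})\big((\mathbf{y}-\boldsymbol\mu)\otimes(\mathbf{y}-\boldsymbol\mu)\big).$$ (ii) Let $\boldsymbol\theta\in\mathbb{R}^\ell$ be a functional that is Fisher consistent for $\boldsymbol\theta_0$ and which possesses an influence function given by $$\mathrm{IF}(\mathbf{y};\boldsymbol\theta,P)=\alpha_C(d(\mathbf{y}))\big(\mathbf{L}^T(\mathbf{\Sigma}^{-1}\otimes\mathbf{\Sigma}^{-1})\mathbf{L}\big)^{-1}\mathbf{L}^T\,\mathrm{vec}\big(\mathbf{\Sigma}^{-1}(\mathbf{y}-\boldsymbol\mu)(\mathbf{y}-\boldsymbol\mu)^T\mathbf{\Sigma}^{-1}\big)-\beta_C(d(\mathbf{y}))\,\boldsymbol\theta_0 .$$ Let $H(\boldsymbol\theta)\in\mathbb{R}^m$ be continuously differentiable in a neighborhood of $\boldsymbol\theta(P)$ and homogeneous of order zero. Then $\mathrm{IF}(\mathbf{y};H(\boldsymbol\theta),P)$ is given by $$\alpha_C(d(\mathbf{y}))\,H'(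\boldsymbol\theta_0)\big(\mathbf{L}^T(\mathbf{\Sigma}^{-1}\otimes\mathbf{\Sigma}^{-1})\mathbf{L}\big)^{-1}\mathbf{L}^T(\mathbf{\Sigma}^{-1}\otimes\mathbf{\Sigma}^{-1})\big((\mathbf{y}-\boldsymbol\mu)\otimes(\mathbf{y}-\boldsymbol\mu)\big).$$
   Context: $\mathrm{PDS}(k)$ is the class of positive definite symmetric $k\times k$ matrices; $\mathrm{vec}$ stacks the columns of a matrix; $\otimes$ is the Kronecker product. A functional assigns to probability measures on $\mathbb{R}^k$ a matrix ($\mathbf{M}(\cdot)\in\mathrm{PDS}(k)$) or vector ($\boldsymbol\theta(\cdot)\in\mathbb{R}^\ell$); it is Fisher consistent for $\mathbf{\Sigma}$ (resp. $\boldsymbol\theta_0$) if $\mathbf{M}(P)=\mathbf{\Sigma}$ (resp. $\boldsymbol\theta(P)=\boldsymbol\theta_0$). The influence function of a functional $\mathbf{T}$ at $P$ is $$\mathrm{IF}(\mathbf{y};\mathbf{T},P)=\lim_{h\downarrow0}\frac{\mathbf{T}((1-h)P+h\delta_{\mathbf{y}})-\mathbf{T}(P)}{h},\qquad \mathbf{y}\in\mathbb{R}^k,$$ if the limit exists, with $\delta_{\mathbf{y}}$ the Dirac measure at $\mathbf{y}$. $H(\mathbf{M})$ and $H(\boldsymbol\theta)$ also denote the functionals $Q\mapsto H(\mathbf{M}(Q))$ and $Q\mapsto H(\boldsymbol\theta(Q))$. A mapping $H$ is homogeneous of order zero if $H(\alpha\mathbf{v})=H(\mathbf{v})$ for all $\alpha>0$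 and all $\mathbf{v}$ in its domain. For a matrix argument, $H'(\mathbf{C})=\partial H(\mathbf{C})/\partial\,\mathrm{vec}(\mathbf{C})^T$ is the $m\times k^2$ matrix of partial derivatives, with $H$ regarded as a function of the $k^2$ entries of $\mathbf{C}$ (continuous differentiability is understood in this sense). For a vector argument, $H'(\boldsymbol\theta)=\partial H(\boldsymbol\theta)/\partial\boldsymbol\theta^T$ is the $m\times\ell$ Jacobian matrix. *)

theory Defs
  imports "HOL-Probability.Probability"
begin

definition pds :: "real^'k^'k \<Rightarrow> bool" where
  "pds A \<longleftrightarrow> transpose A = A \<and> (\<forall>x. x \<noteq> 0 \<longrightarrow> x \<bullet> (A *v x) > 0)"

text \<open>
  Vectors of length \<open>k\<^sup>2\<close> are indexed by pairs, read lexicographically. Stacking columns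
  therefore puts the entry in row \<open>i\<close> and column \<open>j\<close> of a matrix at position \<open>(j, i)\<close>.
\<close>

definition vecop :: "real^'n^'m \<Rightarrow> real^('n \<times> 'm)" where
  "vecop A = (\<chi> p. A $ snd p $ fst p)"

definition unvec :: "real^('n \<times> 'm) \<Rightarrow> real^'n^'m" where
  "unvec v = (\<chi> i j. v $ (j, i))"

definition kron :: "real^'a^'b \<Rightarrow> real^'c^'d \<Rightarrow> real^('a \<times> 'c)^('b \<times> 'd)" where
  "kron A B = (\<chi> p q. A $ fst p $ fst q * B $ snd p $ snd q)"

definition kron_vec :: "real^'a \<Rightarrow> real^'b \<Rightarrow> real^('a \<times> 'b)" where
  "kron_vec x y = (\<chi> p. x $ fst p * y $ snd p)"

definition outer :: "real^'m \<Rightarrow> real^'n \<Rightarrow> real^'n^'m" where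
  "outer x y = (\<chi> i j. x $ i * y $ j)"

lemma unvec_vecop [simp]: "unvec (vecop A) = A"
  by (simp add: unvec_def vecop_def vec_eq_iff)

lemma vecop_unvec [simp]: "vecop (unvec v) = v"
  by (simp add: unvec_def vecop_def vec_eq_iff)

lemma vecop_mult: "vecop (A ** B ** C) = kron (transpose C) A *v vecop B"
  by (simp add: vecop_def kron_def transpose_def matrix_matrix_mult_def
      matrix_vector_mult_def vec_eq_iff sum_distrib_left sum_distrib_right
      UNIV_Times_UNIV[symmetric] sum.cartesian_product' mult_ac
      del: UNIV_Times_UNIV)

lemma vecop_outer: "vecop (outer x y) = kron_vec y x"
  by (simp add: vecop_def outer_def kron_vec_def vec_eq_iff mult.commute)

definition linear_structure :: "('l \<Rightarrow> real^'k^'k) \<Rightarrow> real^'l \<Rightarrow> real^'k^'k" where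
  "linear_structure Ls \<theta> = (\<Sum>j\<in>UNIV. \<theta> $ j *\<^sub>R Ls j)"

definition design_matrix :: "('l \<Rightarrow> real^'k^'k) \<Rightarrow> real^'l^('k \<times> 'k)" where
  "design_matrix Ls = (\<chi> p j. vecop (Ls j) $ p)"

definition sq_mahalanobis :: "real^'k \<Rightarrow> real^'k^'k \<Rightarrow> real^'k \<Rightarrow> real" where
  "sq_mahalanobis \<mu> S y = (y - \<mu>) \<bullet> (matrix_inv S *v (y - \<mu>))"

definition mahalanobis :: "real^'k \<Rightarrow> real^'k^'k \<Rightarrow> real^'k \<Rightarrow> real" where
  "mahalanobis \<mu> S y = sqrt (sq_mahalanobis \<mu> S y)"

definition elliptical :: "(real^'k) measure \<Rightarrow> real^'k \<Rightarrow> real^'k^'k \<Rightarrow> (real \<Rightarrow> real) \<Rightarrow> bool" where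
  "elliptical P \<mu> S g \<longleftrightarrow>
     P \<in> space (prob_algebra borel) \<and> (\<forall>t\<ge>0. g t \<ge> 0) \<and>
     distributed P lborel (\<lambda>y. y) (\<lambda>y. ennreal (det S powr (-1/2) * g (sq_mahalanobis \<mu> S y)))"

text \<open>The contaminated measure \<open>(1 - h) P + h \<delta>\<^sub>y\<close>.\<close>

definition contaminate :: "(real^'k) measure \<Rightarrow> real^'k \<Rightarrow> real \<Rightarrow> (real^'k) measure" where
  "contaminate P y h = measure_of UNIV (sets borel)
     (\<lambda>A. ennreal (1 - h) * emeasure P A + ennreal h * emeasure (return borel y) A)"

lemma sets_contaminate [simp]: "sets (contaminate P y h) = sets borel"
  unfolding contaminate_def
  by (metis sets.sets_measure_of_eq space_borel)

lemma emeasure_contaminate: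
  fixes P :: "(real^'k) measure"
  assumes "sets P = sets borel" "A \<in> sets borel"
  shows "emeasure (contaminate P y h) A
           = ennreal (1 - h) * emeasure P A + ennreal h * emeasure (return borel y) A"
proof (rule emeasure_measure_of[OF contaminate_def])
  show "positive (sets (contaminate P y h))
     (\<lambda>A. ennreal (1 - h) * emeasure P A + ennreal h * emeasure (return borel y) A)"
    by (simp add: positive_def)
  show "countably_additive (sets (contaminate P y h))
     (\<lambda>A. ennreal (1 - h) * emeasure P A + ennreal h * emeasure (return borel y) A)"
  proof (rule countably_additiveI)
    fix F :: "nat \<Rightarrow> (real^'k) set"
    assume F: "range F \<subseteq> sets (contaminate P y h)" "disjoint_family F"
    then have "(\<Sum>i. emeasure P (F i)) = emeasure P (\<Union>i. F i)"
      and "(\<Sum>i. emeasure (return borel y) (F i)) = emeasure (return borel y) (\<Union>i. F i)"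
      using assms(1) by (simp_all add: suminf_emeasure del: emeasure_return)
    then show "(\<Sum>i. ennreal (1 - h) * emeasure P (F i) + ennreal h * emeasure (return borel y) (F i))
        = ennreal (1 - h) * emeasure P (\<Union>i. F i) + ennreal h * emeasure (return borel y) (\<Union>i. F i)"
      by (simp add: suminf_add[symmetric] ennreal_suminf_cmult del: emeasure_return)
  qed
qed (use assms in \<open>auto simp: sets.space_closed\<close>)

lemma contaminate_prob:
  assumes "P \<in> space (prob_algebra borel)" "0 \<le> h" "h \<le> 1"
  shows "contaminate P y h \<in> space (prob_algebra borel)"
proof -
  have P: "prob_space P" "sets P = sets borel"
    using assms(1) by (auto simp: space_prob_algebra)
  have "space P = UNIV" "space (contaminate P y h) = UNIV"
    using sets_eq_imp_space_eq[OF P(2)]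
      sets_eq_imp_space_eq[OF sets_contaminate[of P y h]] by auto
  moreover have "ennreal (1 - h) + ennreal h = 1"
    using assms by (simp flip: ennreal_plus)
  ultimately have "emeasure (contaminate P y h) (space (contaminate P y h)) = 1"
    using prob_space.emeasure_space_1[OF P(1)] P(2) by (simp add: emeasure_contaminate)
  then show ?thesis
    by (auto simp: space_prob_algebra intro: prob_spaceI)
qed

text \<open>
  A functional is a function \<open>T\<close> together with the class \<open>D\<close> of probability measures on which it
  is defined. That \<open>v\<close> is the influence function of \<open>T\<close> at \<open>P\<close> in \<open>y\<close> includes that
  \<open>(1 - h) P + h \<delta>\<^sub>y\<close> belongs to \<open>D\<close> for all small \<open>h > 0\<close>, which is automatic when \<open>D\<close>
  consists of all Borel probability measures.
\<close>

definition has_influence ::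
  "(real^'k) measure set \<Rightarrow> ((real^'k) measure \<Rightarrow> 'b::real_normed_vector) \<Rightarrow>
   (real^'k) measure \<Rightarrow> real^'k \<Rightarrow> 'b \<Rightarrow> bool" where
  "has_influence D T P y v \<longleftrightarrow>
     P \<in> D \<and> (\<forall>\<^sub>F h in at_right 0. contaminate P y h \<in> D) \<and>
     ((\<lambda>h. (T (contaminate P y h) - T P) /\<^sub>R h) \<longlongrightarrow> v) (at_right 0)"

definition homogeneous_zero_on :: "'a::real_vector set \<Rightarrow> ('a \<Rightarrow> 'b) \<Rightarrow> bool" where
  "homogeneous_zero_on S H \<longleftrightarrow> (\<forall>v\<in>S. \<forall>a>0. a *\<^sub>R v \<in> S \<and> H (a *\<^sub>R v) = H v)"

text \<open>Continuous differentiability of a function with domain \<open>S\<close> in a neighbourhood of \<open>x\<close>.\<close>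

definition cont_diff_near :: "(real^'n) set \<Rightarrow> (real^'n \<Rightarrow> real^'m) \<Rightarrow> real^'n \<Rightarrow> bool" where
  "cont_diff_near S f x \<longleftrightarrow>
     (\<exists>U. open U \<and> x \<in> U \<and> U \<subseteq> S \<and> (\<forall>u\<in>U. f differentiable (at u)) \<and>
          continuous_on U (\<lambda>u. jacobian f (at u)))"

text \<open>
  A function of a matrix is differentiated as a function of its \<open>k\<^sup>2\<close> entries, without imposing
  symmetry.
\<close>

definition mat_cont_diff_near ::
  "(real^'k^'k) set \<Rightarrow> (real^'k^'k \<Rightarrow> real^'m) \<Rightarrow> real^'k^'k \<Rightarrow> bool" where
  "mat_cont_diff_near S H C \<longleftrightarrow> cont_diff_near (vecop ` S) (\<lambda>v. H (unvec v)) (vecop C)"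

definition mat_jacobian ::
  "(real^'k^'k \<Rightarrow> real^'m) \<Rightarrow> real^'k^'k \<Rightarrow> real^('k \<times> 'k)^'m" where
  "mat_jacobian H C = jacobian (\<lambda>v. H (unvec v)) (at (vecop C))"

end

theory Submission
  imports Defs
begin

text \<open>
  The influence function is the right derivative at \<open>h = 0\<close> of the functional along the
  contaminated measures, so the chain rule applies: composing with \<open>H\<close> multiplies it by
  \<open>H'\<close>. Differentiating \<open>H (a x) = H x\<close> in \<open>a\<close> at \<open>a = 1\<close> gives Euler's relation
  \<open>H' (x) x = 0\<close>, which removes the term with \<open>\<beta>\<^sub>C\<close>, since that term is a multiple of
  the point at which \<open>H'\<close> is taken. The remaining term is rewritten with
  \<open>vec (A B C) = (C\<^sup>T \<otimes> A) vec B\<close>.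
\<close>

text \<open>Up to norms, the remainder of the linear approximation divided by \<open>h - x\<close>
  is the difference quotient minus \<open>w\<close>. This links the limit that defines an influence
  function to the calculus of derivatives.\<close>

lemma has_vector_derivative_iff_tendsto:
  "(f has_vector_derivative w) (at x within S)
    \<longleftrightarrow> ((\<lambda>h. (f h - f x) /\<^sub>R (h - x)) \<longlongrightarrow> w) (at x within S)"
proof -
  have "norm (f h - f x - (h - x) *\<^sub>R w) / norm (h - x) = norm ((f h - f x) /\<^sub>R (h - x) - w)"
    if "h \<noteq> x" for h
  proof -
    have "(f h - f x) /\<^sub>R (h - x) - w = (f h - f x - (h - x) *\<^sub>R w) /\<^sub>R (h - x)"
      using that by (simp add: scaleR_diff_right)
    then show ?thesis
      by (simp add: divide_inverse_commute)
  qed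
  then have "((\<lambda>h. norm (f h - f x - (h - x) *\<^sub>R w) / norm (h - x)) \<longlongrightarrow> 0) (at x within S)
      \<longleftrightarrow> ((\<lambda>h. norm ((f h - f x) /\<^sub>R (h - x) - w)) \<longlongrightarrow> 0) (at x within S)"
    by (intro tendsto_cong) (auto simp: eventually_at_filter)
  then show ?thesis
    by (simp add: has_vector_derivative_def has_derivative_iff_norm bounded_linear_scaleR_left
        tendsto_norm_zero_iff Lim_null[of _ w])
qed

lemma has_influence_compose:
  fixes T :: "(real^'k) measure \<Rightarrow> 'b::real_normed_vector"
  assumes T: "has_influence D T P y v"
    and H: "(H has_derivative H') (at (T P))"
  shows "has_influence D (\<lambda>Q. H (T Q)) P y (H' v)"
proof -
  \<comment> \<open>The value at 0 is prescribed, because \<open>contaminate P y 0 = P\<close> holds only when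
    \<open>sets P = sets borel\<close>.\<close>
  define c where "c h = (if h = 0 then T P else T (contaminate P y h))" for h :: real
  \<comment> \<open>The quotients agree for \<open>h > 0\<close>, which is all that the right limit
    sees. \<open>G\<close> is left general because both the identity and \<open>H\<close> are
    inserted below.\<close>
  have deriv_iff: "((\<lambda>h. G (c h)) has_vector_derivative w) (at 0 within {0..})
      \<longleftrightarrow> ((\<lambda>h. (G (T (contaminate P y h)) - G (T P)) /\<^sub>R h) \<longlongrightarrow> w) (at_right 0)"
    for G :: "'b \<Rightarrow> 'x::real_normed_vector" and w
    unfolding has_vector_derivative_iff_tendsto at_within_Ici_at_right
    by (rule tendsto_cong) (auto simp: eventually_at_filter c_def)
  have "(c has_vector_derivative v) (at 0 within {0..})"
    using T deriv_iff[of "\<lambda>x. x" v] by (simp add: has_influence_def)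
  moreover have "(H has_derivative H') (at (c 0) within c ` {0..})"
    using H by (simp add: c_def has_derivative_at_withinI)
  ultimately have "((\<lambda>h. H (c h)) has_vector_derivative H' v) (at 0 within {0..})"
    using vector_derivative_diff_chain_within by (fastforce simp: o_def)
  then show ?thesis
    using T deriv_iff[of H "H' v"] by (simp add: has_influence_def)
qed

lemma homogeneous_zero_derivative:
  assumes hom: "homogeneous_zero_on S H" and "x \<in> S"
    and H: "(H has_derivative H') (at x)"
  shows "H' x = 0"
proof -
  have "((\<lambda>a. a *\<^sub>R x) has_vector_derivative x) (at 1)"
    by (auto intro!: derivative_eq_intros)
  then have "((\<lambda>a. H (a *\<^sub>R x)) has_vector_derivative H' x) (at 1)"
    using vector_derivative_diff_chain_within[of "\<lambda>a. a *\<^sub>R x" x 1 UNIV H H']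
      has_derivative_at_withinI[OF H] by (simp add: o_def)
  moreover have "((\<lambda>a. H (a *\<^sub>R x)) has_vector_derivative 0) (at 1)"
  \<comment> \<open>Homogeneity speaks of positive factors only; \<open>{0<..}\<close> is an open
    set around 1 on which the function is constant.\<close>
  proof (rule has_vector_derivative_transform_within_open[of "\<lambda>_. H x" _ _ "{0<..}"])
    show "H x = H (a *\<^sub>R x)" if "a \<in> {0<..}" for a :: real
      using that hom \<open>x \<in> S\<close> by (simp add: homogeneous_zero_on_def)
  qed auto
  ultimately show ?thesis
    by (rule vector_derivative_unique_at)
qed

lemma cont_diff_near_has_derivative:
  assumes "cont_diff_near S f x"
  shows "x \<in> S" and "(f has_derivative (\<lambda>v. jacobian f (at x) *v v)) (at x)"
  using assms by (auto simp: cont_diff_near_def jacobian_works[symmetric])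

text \<open>Common core of both parts of the theorem: \<open>T\<close> becomes \<open>vecop\<close>
  of the covariance functional in one and the parameter functional in the other. The subtracted term
  is a multiple of \<open>T P\<close>, so Euler's relation at \<open>T P\<close> annihilates
  it.\<close>

lemma has_influence_homogeneous_zero:
  fixes H :: "real^'n \<Rightarrow> real^'m"
  assumes T: "has_influence D T P y (a *\<^sub>R w - b *\<^sub>R T P)"
    and H: "cont_diff_near S H (T P)" "homogeneous_zero_on S H"
  shows "has_influence D (\<lambda>Q. H (T Q)) P y (a *\<^sub>R (jacobian H (at (T P)) *v w))"
proof -
  note dH = cont_diff_near_has_derivative[OF H(1)]
  have "jacobian H (at (T P)) *v T P = 0"
    using homogeneous_zero_derivative[OF H(2) dH] .
  with has_influence_compose[OF T dH(2)] show ?thesis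
    by (simp add: matrix_vector_mult_diff_distrib matrix_vector_mult_scaleR)
qed

lemma pds_invertible:
  assumes "pds A"
  shows "invertible A"
proof -
  have "x = 0" if "A *v x = 0" for x
  proof (rule ccontr)
    assume "x \<noteq> 0"
    then have "x \<bullet> (A *v x) > 0"
      using assms by (simp add: pds_def)
    with that show False
      by simp
  qed
  then show ?thesis
    by (simp add: invertible_left_inverse matrix_left_invertible_ker)
qed

lemma transpose_matrix_inv:
  fixes A :: "real^'n^'n"
  assumes "invertible A"
  shows "transpose (matrix_inv A) = matrix_inv (transpose A)"
proof -
  \<comment> \<open>\<open>matrix_inv\<close> is a choice among two-sided inverses, so its equations
    follow once one exists.\<close>
  have inv: "B ** matrix_inv B = mat 1 \<and> matrix_inv B ** B = mat 1"
    if "invertible B" for B :: "real^'n^'n"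
    using that unfolding invertible_def matrix_inv_def by (rule someI_ex)
  \<comment> \<open>An identity matrix is inserted on the right; regrouping then cancels the other
    two factors.\<close>
  have "transpose (matrix_inv A) = transpose (matrix_inv A) ** (transpose A ** matrix_inv (transpose A))"
    using inv[OF transpose_invertible[OF assms]] by simp
  also have "\<dots> = transpose (A ** matrix_inv A) ** matrix_inv (transpose A)"
    by (simp add: matrix_transpose_mul matrix_mul_assoc)
  also have "\<dots> = matrix_inv (transpose A)"
    using inv[OF assms] by simp
  finally show ?thesis .
qed

lemma unvec_scaleR: "unvec (a *\<^sub>R v) = a *\<^sub>R unvec v"
  by (simp add: unvec_def vec_eq_iff)

lemma vecop_scaleR: "vecop (a *\<^sub>R A) = a *\<^sub>R vecop A"
  by (simp add: vecop_def vec_eq_iff)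

text \<open>Scaling commutes with vectorization, so a function of a matrix can be treated as the
  function of its stacked entries to which Euler's relation applies.\<close>

lemma homogeneous_zero_on_unvec:
  assumes "homogeneous_zero_on S H"
  shows "homogeneous_zero_on (vecop ` S) (\<lambda>v. H (unvec v))"
  using assms by (auto simp: homogeneous_zero_on_def unvec_scaleR simp flip: vecop_scaleR)

theorem lemma2:
  fixes P :: "(real^'k) measure" and \<mu> :: "real^'k" and Sig :: "real^'k^'k"
    and g :: "real \<Rightarrow> real"
    and Ls :: "'l::finite \<Rightarrow> real^'k^'k" and \<theta>\<^sub>0 :: "real^'l"
    and \<alpha>C \<beta>C :: "real \<Rightarrow> real"
    and L :: "real^'l^('k \<times> 'k)" and K :: "real^('k \<times> 'k)^('k \<times> 'k)"
    and d :: "real^'k \<Rightarrow> real"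
  defines "L \<equiv> design_matrix Ls"
    and "K \<equiv> kron (matrix_inv Sig) (matrix_inv Sig)"
    and "d \<equiv> mahalanobis \<mu> Sig"
  assumes "pds Sig"
    and "elliptical P \<mu> Sig g"
    and "\<And>j. transpose (Ls j) = Ls j"
    and "Sig = linear_structure Ls \<theta>\<^sub>0"
    and "rank L = CARD('l)"
  shows
    "(\<forall>(D :: (real^'k) measure set) (M :: (real^'k) measure \<Rightarrow> real^'k^'k)
        (S :: (real^'k^'k) set) (H :: real^'k^'k \<Rightarrow> real^'m).
        D \<subseteq> space (prob_algebra borel) \<longrightarrow> P \<in> D \<longrightarrow>
        (\<forall>Q\<in>D. pds (M Q)) \<longrightarrow>
        M P = Sig \<longrightarrow>
        (\<forall>y. has_influence D (\<lambda>Q. vecop (M Q)) P y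
           (\<alpha>C (d y) *\<^sub>R ((L ** matrix_inv (transpose L ** K ** L) ** transpose L) *v
              vecop (matrix_inv Sig ** outer (y - \<mu>) (y - \<mu>) ** matrix_inv Sig))
            - \<beta>C (d y) *\<^sub>R vecop Sig)) \<longrightarrow>
        (\<forall>Q\<in>D. M Q \<in> S) \<longrightarrow>
        mat_cont_diff_near S H (M P) \<longrightarrow>
        homogeneous_zero_on S H \<longrightarrow>
        (\<forall>y. has_influence D (\<lambda>Q. H (M Q)) P y
           (\<alpha>C (d y) *\<^sub>R ((mat_jacobian H Sig ** L ** matrix_inv (transpose L ** K ** L)
              ** transpose L ** K) *v kron_vec (y - \<mu>) (y - \<mu>))))) \<and>
     (\<forall>(D :: (real^'k) measure set) (\<theta> :: (real^'k) measure \<Rightarrow> real^'l)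
        (S :: (real^'l) set) (H :: real^'l \<Rightarrow> real^'m).
        D \<subseteq> space (prob_algebra borel) \<longrightarrow> P \<in> D \<longrightarrow>
        \<theta> P = \<theta>\<^sub>0 \<longrightarrow>
        (\<forall>y. has_influence D \<theta> P y
           (\<alpha>C (d y) *\<^sub>R ((matrix_inv (transpose L ** K ** L) ** transpose L) *v
              vecop (matrix_inv Sig ** outer (y - \<mu>) (y - \<mu>) ** matrix_inv Sig))
            - \<beta>C (d y) *\<^sub>R \<theta>\<^sub>0)) \<longrightarrow>
        (\<forall>Q\<in>D. \<theta> Q \<in> S) \<longrightarrow>
        cont_diff_near S H (\<theta> P) \<longrightarrow>
        homogeneous_zero_on S H \<longrightarrow>
        (\<forall>y. has_influence D (\<lambda>Q. H (\<theta> Q)) P y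
           (\<alpha>C (d y) *\<^sub>R ((jacobian H (at \<theta>\<^sub>0) ** matrix_inv (transpose L ** K ** L)
              ** transpose L ** K) *v kron_vec (y - \<mu>) (y - \<mu>)))))"
proof -
  let ?V = "\<lambda>y. vecop (matrix_inv Sig ** outer (y - \<mu>) (y - \<mu>) ** matrix_inv Sig)"
  have "transpose (matrix_inv Sig) = matrix_inv Sig"
    using transpose_matrix_inv[OF pds_invertible[OF \<open>pds Sig\<close>]] \<open>pds Sig\<close>
    by (simp add: pds_def)
  \<comment> \<open>Symmetry of the inverse of \<open>Sig\<close> removes the transpose that
    \<open>vecop_mult\<close> puts on the first Kronecker factor.\<close>
  then have V: "?V y = K *v kron_vec (y - \<mu>) (y - \<mu>)" for y
    by (simp add: vecop_mult vecop_outer K_def)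
  show ?thesis
  proof (intro conjI allI impI)
    fix D S y and M :: "(real^'k) measure \<Rightarrow> real^'k^'k" and H :: "real^'k^'k \<Rightarrow> real^'m"
    assume M: "M P = Sig" and H: "mat_cont_diff_near S H (M P)" "homogeneous_zero_on S H"
      and "\<forall>y. has_influence D (\<lambda>Q. vecop (M Q)) P y
           (\<alpha>C (d y) *\<^sub>R ((L ** matrix_inv (transpose L ** K ** L) ** transpose L) *v ?V y)
            - \<beta>C (d y) *\<^sub>R vecop Sig)"
    \<comment> \<open>Fisher consistency turns \<open>Sig\<close> in the last term into
      \<open>M P\<close>, the point at which Euler's relation is used.\<close>
    then have "has_influence D (\<lambda>Q. vecop (M Q)) P y
           (\<alpha>C (d y) *\<^sub>R ((L ** matrix_inv (transpose L ** K ** L) ** transpose L) *v ?V y)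
            - \<beta>C (d y) *\<^sub>R vecop (M P))"
      by simp
    from has_influence_homogeneous_zero[OF this
        H(1)[unfolded mat_cont_diff_near_def] homogeneous_zero_on_unvec[OF H(2)]]
    show "has_influence D (\<lambda>Q. H (M Q)) P y
           (\<alpha>C (d y) *\<^sub>R ((mat_jacobian H Sig ** L ** matrix_inv (transpose L ** K ** L)
              ** transpose L ** K) *v kron_vec (y - \<mu>) (y - \<mu>)))"
      by (simp add: M V mat_jacobian_def matrix_vector_mul_assoc matrix_mul_assoc)
  next
    fix D S y and \<theta> :: "(real^'k) measure \<Rightarrow> real^'l" and H :: "real^'l \<Rightarrow> real^'m"
    assume \<theta>: "\<theta> P = \<theta>\<^sub>0" and H: "cont_diff_near S H (\<theta> P)" "homogeneous_zero_on S H"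
      and "\<forall>y. has_influence D \<theta> P y
           (\<alpha>C (d y) *\<^sub>R ((matrix_inv (transpose L ** K ** L) ** transpose L) *v ?V y)
            - \<beta>C (d y) *\<^sub>R \<theta>\<^sub>0)"
    \<comment> \<open>The same replacement of \<open>\<theta>\<^sub>0\<close> by
      \<open>\<theta> P\<close>; this functional is a vector already and needs no
      vectorization.\<close>
    then have "has_influence D \<theta> P y
           (\<alpha>C (d y) *\<^sub>R ((matrix_inv (transpose L ** K ** L) ** transpose L) *v ?V y)
            - \<beta>C (d y) *\<^sub>R \<theta> P)"
      by simp
    from has_influence_homogeneous_zero[OF this H]
    show "has_influence D (\<lambda>Q. H (\<theta> Q)) P y
           (\<alpha>C (d y) *\<^sub>R ((jacobian H (at \<theta>\<^sub>0) ** matrix_inv (transpose L ** K ** L)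
              ** transpose L ** K) *v kron_vec (y - \<mu>) (y - \<mu>)))"
      by (simp add: \<theta> V matrix_vector_mul_assoc matrix_mul_assoc)
  qed
qed

end
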